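(* Let $A\in\mathbb{R}^{n\times n}$, $\mathbf{v},\mathbf{w}\in\mathbb{R}^n$, and $\hat A=A+\mathbf{v}\mathbf{w}^T$, and suppose that all leading principal minors of $A$ and of $\hat A$ are nonzero. Let $L$ and $\hat L$ be the lower-triangular factors of the REF-LU factorizations of $A$ and $\hat A$, respectively. Let $\mathbf{y}^{(k)}$ and $\hat{\mathbf{y}}^{(k)}$ be the intermediary forward substitution vectors obtained at the conclusion of the $k$th iteration of REF forward substitution on $\mathbf{v}$ using $L$ and $\hat L$, respectively. Then $\mathbf{y}^{(k)}=\hat{\mathbf{y}}^{(k)}$ for all $k=1,\dots,n-1$.
   Context: Let $M\in\mathbb{R}^{n\times n}$ have all leading principal minors nonzero. Integer-preserving Gaussian elimination (IPGE) on $M$ (no permutations): $m^{(0)}_{i,j}=m_{i,j}$, $\rho^{(0)}=1$, and for $k=1,\dots,n$, with pivot $\rho^{(k)}=m^{(k-1)}_{k,k}$, set, for $k\le i,j\le n$, $m^{(k)}_{i,j}=m^{(k-1)}_{i,j}$ if $i=k$, and $m^{(k)}_{i,j}=\bigl(\rho^{(k)}m^{(k-1)}_{i,j}-m^{(k-1)}_{k,j}m^{(k-1)}_{i,k}\bigr)/\rho^{(k-1)}$ otherwise. (The pivot $\rho^{(k)}$ equals the $k$th leading principal minor of $M$, hence is nonzero.) The REF-LU factorization of $M$ is the triple $L,D,U$ where $L$ is lower triangular with $l_{i,j}=m^{(j-1)}_{i,j}$ for $i\ge j$, $D$ is diagonal with $d_{i,i}=\rho^{(i-1)}\rho^{(i)}$,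 and $U$ is upper triangular with $u_{i,j}=m^{(i-1)}_{i,j}$ for $i\le j$; it satisfies $M=LD^{-1}U$ and $l_{i,i}=u_{i,i}=\rho^{(i)}$. REF forward substitution on a vector $\mathbf{b}$ using a lower-triangular factor $L$ produces vectors $\mathbf{y}^{(0)}=\mathbf{b},\mathbf{y}^{(1)},\dots,\mathbf{y}^{(n-1)}$ by the following recursion, for $k=1,\dots,n-1$ and with the convention $l_{0,0}=1$: $y^{(k)}_i=y^{(k-1)}_i$ for $i\le k$, and $y^{(k)}_i=\bigl(l_{k,k}\,y^{(k-1)}_i-l_{i,k}\,y^{(k-1)}_k\bigr)/l_{k-1,k-1}$ for $i>k$. *)

theory Defs
  imports
    Complex_Main
    "Jordan_Normal_Form.Matrix"
    "Jordan_Normal_Form.Determinant"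
    "Jordan_Normal_Form.DL_Submatrix"
begin

text \<open>
  Matrix and vector entries are indexed from 0, while iterations, pivots and leading principal
  minors are numbered from 1. So the pivot of iteration \<open>Suc k\<close> sits at position \<open>(k, k)\<close>, and
  the entry written $m^{(k)}_{i,j}$ with indices starting at 1 is \<open>ipge M k $$ (i - 1, j - 1)\<close>.
\<close>

definition leading_principal_minor :: "'a :: comm_ring_1 mat \<Rightarrow> nat \<Rightarrow> 'a" where
  "leading_principal_minor M k = det (submatrix M {..<k} {..<k})"

text \<open>
  Iteration \<open>Suc k\<close> is specified only for rows and columns with index at least \<open>k\<close>; all other
  entries are carried over unchanged, and nothing below reads them.
\<close>

fun ipge :: "'a :: field mat \<Rightarrow> nat \<Rightarrow> 'a mat"
  and ipge_pivot :: "'a :: field mat \<Rightarrow> nat \<Rightarrow> 'a" where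
  "ipge M 0 = M"
| "ipge M (Suc k) = mat (dim_row M) (dim_col M) (\<lambda>(i, j).
     if k < i \<and> k \<le> j
     then (ipge_pivot M (Suc k) * ipge M k $$ (i, j) - ipge M k $$ (k, j) * ipge M k $$ (i, k))
            / ipge_pivot M k
     else ipge M k $$ (i, j))"
| "ipge_pivot M 0 = 1"
| "ipge_pivot M (Suc k) = ipge M k $$ (k, k)"

definition ref_lu :: "'a :: field mat \<Rightarrow> 'a mat \<times> 'a mat \<times> 'a mat" where
  "ref_lu M =
    (let n = dim_row M in
      (mat n n (\<lambda>(i, j). if j \<le> i then ipge M j $$ (i, j) else 0),
       mat n n (\<lambda>(i, j). if i = j then ipge_pivot M i * ipge_pivot M (Suc i) else 0),
       mat n n (\<lambda>(i, j). if i \<le> j then ipge M i $$ (i, j) else 0)))"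

text \<open>The case \<open>k = 0\<close> of the divisor is the convention $l_{0,0} = 1$ (indices from 1).\<close>

fun ref_forward_subst :: "'a :: field mat \<Rightarrow> 'a vec \<Rightarrow> nat \<Rightarrow> 'a vec" where
  "ref_forward_subst L b 0 = b"
| "ref_forward_subst L b (Suc k) =
    (let y = ref_forward_subst L b k in
      vec (dim_vec b) (\<lambda>i.
        if i \<le> k then y $ i
        else (L $$ (k, k) * y $ i - L $$ (i, k) * y $ k)
               / (if k = 0 then 1 else L $$ (k - 1, k - 1))))"

end

theory Submission
  imports Defs
begin

text \<open>
  Up to the factor \<open>ipge_pivot M k\<close>, the trailing block of \<open>ipge M k\<close> is the Schur complement of
  the leading \<open>k \<times> k\<close> block, and forward substitution applies the same elimination to a
  vector. A rank-one update \<open>v w\<^sup>T\<close> of the matrix changes the Schur complement by a rank-one term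
  (Sherman--Morrison), which with the denominators cleared reads
  $\rho^{(k)} \hat m^{(k)}_{i,j} = \hat\rho^{(k)} m^{(k)}_{i,j} + y^{(k)}_i x^{(k)}_j$, where $x$
  is obtained from $w$ by forward substitution with \<open>U\<^sup>T\<close>. Induction on \<open>k\<close> proves this
  together with $\hat y^{(k)} = y^{(k)}$: in the step the terms involving $x$ cancel.
\<close>

lemma pick_lessThan:
  assumes "i < k"
  shows "pick {..<k} i = i"
proof -
  have "{a \<in> {..<k}. a < i} = {..<i}"
    using assms by auto
  then show ?thesis
    using assms pick_card_in_set[of i "{..<k}"] by simp
qed

text \<open>This removes the \<open>pick\<close> reindexing behind \<open>submatrix\<close>, so that
  a leading block can be compared entrywise with a product of triangular matrices.\<close>

lemma leading_submatrix_eq: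
  assumes "M \<in> carrier_mat n n" and "k \<le> n"
  shows "submatrix M {..<k} {..<k} = mat k k (\<lambda>(i, j). M $$ (i, j))"
proof (rule eq_matI)
  have rows: "{i. i < dim_row M \<and> i \<in> {..<k}} = {..<k}"
    and cols: "{j. j < dim_col M \<and> j \<in> {..<k}} = {..<k}"
    using assms by auto
  show "dim_row (submatrix M {..<k} {..<k}) = dim_row (mat k k (\<lambda>(i, j). M $$ (i, j)))"
    and "dim_col (submatrix M {..<k} {..<k}) = dim_col (mat k k (\<lambda>(i, j). M $$ (i, j)))"
    by (simp_all only: dim_submatrix rows cols card_lessThan dim_row_mat dim_col_mat)
  fix i j
  assume "i < dim_row (mat k k (\<lambda>(i, j). M $$ (i, j)))"
    and "j < dim_col (mat k k (\<lambda>(i, j). M $$ (i, j)))"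
  then have ij: "i < k" "j < k" by simp_all
  then show "submatrix M {..<k} {..<k} $$ (i, j) = mat k k (\<lambda>(i, j). M $$ (i, j)) $$ (i, j)"
    by (subst submatrix_index) (simp_all only: rows cols card_lessThan, simp add: pick_lessThan)
qed

lemma dim_ipge [simp]:
  "dim_row (ipge M k) = dim_row M" "dim_col (ipge M k) = dim_col M"
  by (cases k; simp)+

text \<open>Divided by the current pivot, an IPGE step is an ordinary elimination step: it subtracts
  the product of pivot column and pivot row entries. The sum collects these rank-one terms, and the
  last summand is the Schur complement entry that remains.\<close>

lemma ipge_expansion:
  fixes M :: "'a :: field mat"
  assumes "M \<in> carrier_mat n n" and "i < n" and "j < n"
    and "s \<le> i" and "s \<le> j" and "\<And>t. t \<le> s \<Longrightarrow> ipge_pivot M t \<noteq> 0"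
  shows "M $$ (i, j) =
    (\<Sum>t<s. ipge M t $$ (i, t) / ipge_pivot M t * (ipge M t $$ (t, j) / ipge_pivot M (Suc t)))
      + ipge M s $$ (i, j) / ipge_pivot M s"
  using assms(4-6)
proof (induction s)
  case 0
  then show ?case by simp
next
  case (Suc s)
  have nz: "ipge_pivot M s \<noteq> 0" "ipge_pivot M (Suc s) \<noteq> 0"
    using Suc.prems(3)[of s] Suc.prems(3)[of "Suc s"] by auto
  have step: "ipge M s $$ (i, j) / ipge_pivot M s =
    ipge M s $$ (i, s) / ipge_pivot M s * (ipge M s $$ (s, j) / ipge_pivot M (Suc s))
      + ipge M (Suc s) $$ (i, j) / ipge_pivot M (Suc s)"
    using Suc.prems assms nz by (simp add: field_simps)
  have "M $$ (i, j) =
    (\<Sum>t<s. ipge M t $$ (i, t) / ipge_pivot M t * (ipge M t $$ (t, j) / ipge_pivot M (Suc t)))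
      + ipge M s $$ (i, j) / ipge_pivot M s"
    using Suc by simp
  then show ?case unfolding step sum.lessThan_Suc by (simp only: add.assoc)
qed

text \<open>Strong induction: once the earlier pivots are nonzero, the leading block factors as
  \<open>Lt * Ut\<close>, where \<open>Ut\<close> has unit diagonal. A nonzero minor then forces
  every diagonal entry of \<open>Lt\<close> to be nonzero, the last of which contains the pivot in
  question.\<close>

lemma ipge_pivot_nonzero:
  fixes M :: "'a :: field mat"
  assumes M: "M \<in> carrier_mat n n" and "k \<le> n"
    and minors: "\<forall>k\<in>{1..n}. leading_principal_minor M k \<noteq> 0"
  shows "ipge_pivot M k \<noteq> 0"
  using \<open>k \<le> n\<close>
proof (induction k rule: less_induct)
  case (less k)
  show ?case
  proof (cases k)
    case 0
    then show ?thesis by simp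
  next
    case (Suc s)
    have nz: "ipge_pivot M t \<noteq> 0" if "t \<le> s" for t
      using less that Suc by simp
    define Lt where "Lt = mat k k (\<lambda>(i, t).
      if t \<le> i then ipge M t $$ (i, t) / ipge_pivot M t else 0)"
    \<comment> \<open>The diagonal is a literal 1: written as a quotient, its last entry would
      divide by pivot \<open>k\<close>, whose nonvanishing is the claim. Off the diagonal only
      pivots up to \<open>s\<close> occur as divisors.\<close>
    define Ut where "Ut = mat k k (\<lambda>(t, j).
      if t = j then 1 else if t < j then ipge M t $$ (t, j) / ipge_pivot M (Suc t) else 0)"
    have carr: "Lt \<in> carrier_mat k k" "Ut \<in> carrier_mat k k"
      by (simp_all add: Lt_def Ut_def)
    have "mat k k (\<lambda>(i, j). M $$ (i, j)) = Lt * Ut"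
    proof (rule eq_matI)
      fix i j
      assume "i < dim_row (Lt * Ut)" and "j < dim_col (Lt * Ut)"
      then have ij: "i < k" "j < k" using carr by auto
      \<comment> \<open>Triangularity kills all summands beyond \<open>m\<close>; the summand at
        \<open>m\<close> itself supplies the remainder term of the expansion of length
        \<open>m\<close>.\<close>
      define m where "m = min i j"
      have m: "m \<le> i" "m \<le> j" "m < k" "m \<le> s" using ij Suc by (auto simp: m_def)
      have "(Lt * Ut) $$ (i, j) = (\<Sum>t<k. Lt $$ (i, t) * Ut $$ (t, j))"
        using ij carr by (simp add: scalar_prod_def lessThan_atLeast0)
      also have "\<dots> = (\<Sum>t<Suc m. Lt $$ (i, t) * Ut $$ (t, j))"
        using ij m(3) by (intro sum.mono_neutral_right) (auto simp: Lt_def Ut_def m_def)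
      also have "\<dots> = (\<Sum>t<m. ipge M t $$ (i, t) / ipge_pivot M t *
          (ipge M t $$ (t, j) / ipge_pivot M (Suc t))) + Lt $$ (i, m) * Ut $$ (m, j)"
        unfolding sum.lessThan_Suc using ij m
        by (intro arg_cong2[where f = "(+)"] sum.cong refl) (simp add: Lt_def Ut_def)
      also have "Lt $$ (i, m) * Ut $$ (m, j) = ipge M m $$ (i, j) / ipge_pivot M m"
      proof (cases "m = j")
        case True
        then show ?thesis using ij m by (simp add: Lt_def Ut_def)
      next
        case False
        then have "m = i" "i < j" by (auto simp: m_def)
        \<comment> \<open>The numerator of \<open>Lt $$ (i, i)\<close> is pivot
          \<open>Suc i\<close>, which cancels the divisor in \<open>Ut $$ (i, j)\<close>.\<close>
        then show ?thesis using ij m nz[of "Suc i"] Suc by (simp add: Lt_def Ut_def)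
      qed
      also have "(\<Sum>t<m. ipge M t $$ (i, t) / ipge_pivot M t *
          (ipge M t $$ (t, j) / ipge_pivot M (Suc t))) + ipge M m $$ (i, j) / ipge_pivot M m
          = M $$ (i, j)"
        using ij m nz less.prems by (intro ipge_expansion[OF M, symmetric]) auto
      finally show "mat k k (\<lambda>(i, j). M $$ (i, j)) $$ (i, j) = (Lt * Ut) $$ (i, j)"
        using ij by simp
    qed (use carr in auto)
    then have "leading_principal_minor M k = det Lt * det Ut"
      using det_mult[OF carr] leading_submatrix_eq[OF M less.prems]
      by (simp add: leading_principal_minor_def)
    then have "det Lt \<noteq> 0"
      using minors less.prems Suc by fastforce
    moreover have "det Lt = prod_list (diag_mat Lt)"
      by (rule det_lower_triangular[OF _ carr(1)]) (simp add: Lt_def)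
    \<comment> \<open>This entry is pivot \<open>k\<close> divided by pivot
      \<open>s\<close>.\<close>
    ultimately have "Lt $$ (s, s) \<noteq> 0"
      using carr Suc by (auto simp: prod_list_zero_iff diag_mat_def)
    then show ?thesis using Suc by (simp add: Lt_def)
  qed
qed

lemma dim_ref_forward_subst [simp]: "dim_vec (ref_forward_subst L b k) = dim_vec b"
  by (cases k) (simp_all add: Let_def)

text \<open>Here \<open>p\<close>, \<open>q\<close> are the previous pivots, \<open>r\<close>,
  \<open>r'\<close> the new ones, and \<open>a\<close>, \<open>a'\<close> pivot column entries.
  After multiplying by \<open>p\<close>, the two contributions \<open>y * x * yi\<close> cancel and
  a factor \<open>q\<close> comes out.\<close>

lemma cancel_substitution_step:
  fixes p q :: "'a :: field"
  assumes "p \<noteq> 0" and "q \<noteq> 0"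
    and r: "p * r' = q * r + y * x" and a: "p * a' = q * a + yi * x"
  shows "(r' * yi - a' * y) / q = (r * yi - a * y) / p"
proof -
  have "p * (r' * yi - a' * y) = (p * r') * yi - (p * a') * y"
    by (simp add: algebra_simps)
  also have "\<dots> = q * (r * yi - a * y)"
    unfolding r a by (simp add: algebra_simps)
  finally show ?thesis
    using assms(1,2) by (simp add: frac_eq_eq mult.commute)
qed

text \<open>After multiplying by \<open>p * p\<close> and substituting, the products of two rank-one
  terms cancel, since \<open>(y * x) * (yi * xj) = (y * xj) * (yi * x)\<close>. What is left has a
  factor \<open>q\<close> and regroups into the new invariant.\<close>

lemma cancel_elimination_step:
  fixes p q :: "'a :: field"
  assumes "p \<noteq> 0" and "q \<noteq> 0"
    and r: "p * r' = q * r + y * x" and a: "p * a' = q * a + yi * x"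
    and b: "p * b' = q * b + y * xj" and c: "p * c' = q * c + yi * xj"
  shows "r * ((r' * c' - b' * a') / q) =
    r' * ((r * c - b * a) / p) + (r * yi - a * y) / p * ((r * xj - b * x) / p)"
proof -
  define R where "R = p * r' * (r * c - b * a) + (r * yi - a * y) * (r * xj - b * x)"
  have "p * p * (r * (r' * c' - b' * a')) = r * ((p * r') * (p * c') - (p * b') * (p * a'))"
    by (simp add: algebra_simps)
  also have "\<dots> = q * R"
    unfolding R_def r a b c by (simp add: algebra_simps)
  finally have "r * (r' * c' - b' * a') / q = R / (p * p)"
    using assms(1,2) by (simp add: frac_eq_eq mult.commute)
  also have "\<dots> = r' * ((r * c - b * a) / p) + (r * yi - a * y) / p * ((r * xj - b * x) / p)"
    using assms(1) by (simp add: R_def add_divide_distrib)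
  finally show ?thesis by simp
qed

lemma ref_forward_subst_rank_one_update:
  fixes M M' :: "'a :: field mat"
  assumes M: "M \<in> carrier_mat n n" and M': "M' \<in> carrier_mat n n"
    and v: "v \<in> carrier_vec n" and w: "w \<in> carrier_vec n"
    and upd: "\<And>i j. i < n \<Longrightarrow> j < n \<Longrightarrow> M' $$ (i, j) = M $$ (i, j) + v $ i * w $ j"
    and piv: "\<And>k. k \<le> n \<Longrightarrow> ipge_pivot M k \<noteq> 0"
    and piv': "\<And>k. k \<le> n \<Longrightarrow> ipge_pivot M' k \<noteq> 0"
    and lu: "ref_lu M = (L, D, U)" and lu': "ref_lu M' = (L', D', U')"
    and "k \<le> n"
  shows "(\<forall>i j. k \<le> i \<longrightarrow> k \<le> j \<longrightarrow> i < n \<longrightarrow> j < n \<longrightarrow>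
      ipge_pivot M k * ipge M' k $$ (i, j) = ipge_pivot M' k * ipge M k $$ (i, j)
        + ref_forward_subst L v k $ i * ref_forward_subst U\<^sup>T w k $ j)
    \<and> ref_forward_subst L v k = ref_forward_subst L' v k"
  using \<open>k \<le> n\<close>
proof (induction k)
  \<comment> \<open>Both initial pivots are 1, so the invariant is the rank-one update
    itself.\<close>
  case 0
  then show ?case using upd by simp
next
  case (Suc k)
  let ?y = "ref_forward_subst L v k" and ?x = "ref_forward_subst U\<^sup>T w k"
  define p where "p = ipge_pivot M k"
  define q where "q = ipge_pivot M' k"
  define m where "m i j = ipge M k $$ (i, j)" for i j
  define m' where "m' i j = ipge M' k $$ (i, j)" for i j
  have k: "k < n" using Suc.prems by simp
  have L: "L $$ (i, j) = ipge M j $$ (i, j)" "L' $$ (i, j) = ipge M' j $$ (i, j)"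
    "U\<^sup>T $$ (i, j) = ipge M j $$ (j, i)" if "j \<le> i" "i < n" for i j
    using lu lu' M M' that by (auto simp: ref_lu_def Let_def)
  have nz: "p \<noteq> 0" "q \<noteq> 0"
    using piv piv' k by (simp_all add: p_def q_def)
  have yy: "ref_forward_subst L' v k = ?y" using Suc by simp
  have inv: "p * m' i j = q * m i j + ?y $ i * ?x $ j"
    if "k \<le> i" "k \<le> j" "i < n" "j < n" for i j
    using Suc that by (simp add: p_def q_def m_def m'_def)
  \<comment> \<open>Diagonal entry \<open>k - 1\<close> of each factor is pivot \<open>k\<close>, so
    substitution and elimination share their divisors; the convention for \<open>k = 0\<close>
    agrees with \<open>ipge_pivot M 0 = 1\<close>.\<close>
  have div: "(if k = 0 then 1 else L $$ (k - 1, k - 1)) = p"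
    "(if k = 0 then 1 else L' $$ (k - 1, k - 1)) = q"
    "(if k = 0 then 1 else U\<^sup>T $$ (k - 1, k - 1)) = p"
    using L[of "k - 1" "k - 1"] k by (cases k; simp add: p_def q_def)+
  have y: "ref_forward_subst L v (Suc k) $ i =
      (if i \<le> k then ?y $ i else (m k k * ?y $ i - m i k * ?y $ k) / p)" if "i < n" for i
    using that v k by (simp add: Let_def L m_def div)
  have y': "ref_forward_subst L' v (Suc k) $ i =
      (if i \<le> k then ?y $ i else (m' k k * ?y $ i - m' i k * ?y $ k) / q)" if "i < n" for i
    using that v k by (simp add: Let_def L m'_def div yy)
  have x: "ref_forward_subst U\<^sup>T w (Suc k) $ j =
      (if j \<le> k then ?x $ j else (m k k * ?x $ j - m k j * ?x $ k) / p)" if "j < n" for j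
    using that w k by (simp add: Let_def L m_def div)
  have "ref_forward_subst L v (Suc k) = ref_forward_subst L' v (Suc k)"
  proof (rule eq_vecI)
    fix i
    assume "i < dim_vec (ref_forward_subst L' v (Suc k))"
    then have i: "i < n" by (simp only: dim_ref_forward_subst carrier_vecD[OF v])
    \<comment> \<open>The invariant is used in column \<open>k\<close> only, at rows
      \<open>k\<close> and \<open>i\<close>, so both instances carry the same factor
      \<open>?x $ k\<close>.\<close>
    have "(m' k k * ?y $ i - m' i k * ?y $ k) / q = (m k k * ?y $ i - m i k * ?y $ k) / p"
      if "k < i"
      using that i k by (intro cancel_substitution_step[OF nz inv inv]) simp_all
    then show "ref_forward_subst L v (Suc k) $ i = ref_forward_subst L' v (Suc k) $ i"
      unfolding y[OF i] y'[OF i] by simp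
  qed (simp only: dim_ref_forward_subst)
  moreover have "ipge_pivot M (Suc k) * ipge M' (Suc k) $$ (i, j) =
      ipge_pivot M' (Suc k) * ipge M (Suc k) $$ (i, j)
        + ref_forward_subst L v (Suc k) $ i * ref_forward_subst U\<^sup>T w (Suc k) $ j"
    if ij: "Suc k \<le> i" "Suc k \<le> j" "i < n" "j < n" for i j
  proof -
    have "ipge M (Suc k) $$ (i, j) = (m k k * m i j - m k j * m i k) / p"
      "ipge M' (Suc k) $$ (i, j) = (m' k k * m' i j - m' k j * m' i k) / q"
      using ij M M' by (simp_all add: m_def m'_def p_def q_def)
    moreover have "ipge_pivot M (Suc k) = m k k" "ipge_pivot M' (Suc k) = m' k k"
      by (simp_all add: m_def m'_def)
    moreover have "m k k * ((m' k k * m' i j - m' k j * m' i k) / q) =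
      m' k k * ((m k k * m i j - m k j * m i k) / p)
        + (m k k * ?y $ i - m i k * ?y $ k) / p * ((m k k * ?x $ j - m k j * ?x $ k) / p)"
      \<comment> \<open>The four instances of the invariant are at \<open>(k, k)\<close>,
        \<open>(i, k)\<close>, \<open>(k, j)\<close> and \<open>(i, j)\<close>, all in the trailing
        block.\<close>
      using ij k by (intro cancel_elimination_step[OF nz inv inv inv inv]) simp_all
    moreover have "\<not> i \<le> k" "\<not> j \<le> k"
      using ij by simp_all
    ultimately show ?thesis
      by (simp only: y[OF ij(3)] x[OF ij(4)] if_False)
  qed
  ultimately show ?case by blast
qed

theorem theorem5:
  fixes A A' L D U L' D' U' :: "real mat"
    and v w :: "real vec"
    and n :: nat
  assumes "A \<in> carrier_mat n n" and "v \<in> carrier_vec n" and "w \<in> carrier_vec n"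
    and "A' = A + mat_of_cols n [v] * (mat_of_cols n [w])\<^sup>T"
    and "\<forall>k\<in>{1..n}. leading_principal_minor A k \<noteq> 0"
    and "\<forall>k\<in>{1..n}. leading_principal_minor A' k \<noteq> 0"
    and "ref_lu A = (L, D, U)"
    and "ref_lu A' = (L', D', U')"
  shows "\<forall>k\<in>{1..n - 1}. ref_forward_subst L v k = ref_forward_subst L' v k"
proof
  fix k
  assume "k \<in> {1..n - 1}"
  then have k: "k \<le> n" by auto
  have A': "A' \<in> carrier_mat n n"
    unfolding assms(4) by (intro add_carrier_mat carrier_matI) simp_all
  show "ref_forward_subst L v k = ref_forward_subst L' v k"
  proof (rule ref_forward_subst_rank_one_update[THEN conjunct2,
        OF assms(1) A' assms(2,3) _ _ _ assms(7,8) k])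
    \<comment> \<open>The product of an \<open>n\<close> by 1 and a 1 by \<open>n\<close> matrix has
      a single summand in each entry.\<close>
    show "A' $$ (i, j) = A $$ (i, j) + v $ i * w $ j" if "i < n" "j < n" for i j
      unfolding assms(4) using that by (simp add: scalar_prod_def mat_of_cols_index)
    show "ipge_pivot A k \<noteq> 0" if "k \<le> n" for k
      using ipge_pivot_nonzero[OF assms(1) that assms(5)] .
    show "ipge_pivot A' k \<noteq> 0" if "k \<le> n" for k
      using ipge_pivot_nonzero[OF A' that assms(6)] .
  qed
qed

end
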